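(* For the Poisson $i\mathcal{S}$-graph with legitimate-node density $\lambda_\ell>0$ and eavesdropper density $\lambda_{\mathrm e}>0$ (secrecy rate threshold zero, path loss only, equal noise powers), the average in-degree of a typical node is $$\mathbb{E}\{N_{\mathrm{in}}\}=\frac{\lambda_\ell}{\lambda_{\mathrm e}},$$ and the probability $p_{\mathrm{in-isol}}=\mathbb{P}\{N_{\mathrm{in}}=0\}$ that a typical node cannot receive from anyone with positive secrecy rate (in-isolation) is $$p_{\mathrm{in-isol}}=\mathbb{E}\left\{e^{-\frac{\lambda_\ell}{\lambda_{\mathrm e}}\widetilde A}\right\},$$ where $\widetilde A$ is the area of a typical Voronoi cell induced by a unit-density homogeneous Poisson process on $\mathbb{R}^2$.
   Context: Poisson $i\mathcal{S}$-graph (zero threshold, path loss only, equal noise powers): $\Pi_\ell$ (legitimate nodes) and $\Pi_{\mathrm e}$ (eavesdroppers) are mutually independent homogeneous Poisson point processes on $\mathbb{R}^2$ with densities $\lambda_\ell$ and $\lambda_{\mathrm e}$. There is a directed edge $\overrightarrow{xy}$ between distinct legitimate nodes $x,y$ if and only if the maximum secrecy rate of the link is positive, which in this setting is equivalent to $|x-y|<\min_{e\in\Pi_{\mathrm e}}|x-e|$. Typical node: the node at the origin when the graph is built on the legitimate-node set $\Pi_\ell\cup\{0\}$ with eavesdroppers $\Pi_{\mathrm e}$. Its in-degree $N_{\mathrm{in}}$ is the number of $x\in\Pi_\ell$ with an edge $\overrightarrow{x0}$. Typical Voronoi cell induced by a unit-density Poisson process $\widetilde\Pi$: the cell $\{y\in\mathbb{R}^2:|y|<|y-p|\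 \forall p\in\widetilde\Pi\}$ of the point $0$ in $\widetilde\Pi\cup\{0\}$. *)

theory Defs
  imports "HOL-Probability.Probability"
begin

definition locally_finite_sets :: "(real ^ 2) set set" where
  "locally_finite_sets = {X. \<forall>B. bounded B \<longrightarrow> finite (X \<inter> B)}"

(* Only bounded sets are counted, so that card never meets an infinite set. *)
definition config_space :: "(real ^ 2) set measure" where
  "config_space = sigma locally_finite_sets
     {{X \<in> locally_finite_sets. card (X \<inter> B) = n} | B n. B \<in> sets borel \<and> bounded B}"

(* The Poisson mass function is written out because poisson_pmf requires a positive rate,
   while B may be a null set; the convention 0 ^ 0 = 1 then gives an almost surely zero count. *)
definition poisson_process :: "'a measure \<Rightarrow> real \<Rightarrow> ('a \<Rightarrow> (real ^ 2) set) \<Rightarrow> bool" where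
  "poisson_process M lam X \<longleftrightarrow>
     X \<in> measurable M config_space \<and>
     (\<forall>B n. B \<in> sets borel \<and> bounded B \<longrightarrow>
        measure M {\<omega> \<in> space M. card (X \<omega> \<inter> B) = n} =
          (lam * measure lborel B) ^ n / fact n * exp (- (lam * measure lborel B))) \<and>
     (\<forall>(B :: nat \<Rightarrow> (real ^ 2) set) k.
        (\<forall>i<k. B i \<in> sets borel \<and> bounded (B i)) \<and> disjoint_family_on B {..<k} \<longrightarrow>
        prob_space.indep_vars M (\<lambda>_. count_space UNIV) (\<lambda>i \<omega>. card (X \<omega> \<inter> B i)) {..<k})"

(* The condition on E is dist x y < min {dist x e | e \<in> E}, with the minimum over the
   empty set read as infinity. *)
definition iS_graph :: "(real ^ 2) set \<Rightarrow> (real ^ 2) set \<Rightarrow> ((real ^ 2) \<times> (real ^ 2)) set" where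
  "iS_graph V E = {(x, y). x \<in> V \<and> y \<in> V \<and> x \<noteq> y \<and> (\<forall>e\<in>E. dist x y < dist x e)}"

(* Counting measure rather than card, so that an infinite in-degree is not read as 0. *)
definition typical_in_degree :: "(real ^ 2) set \<Rightarrow> (real ^ 2) set \<Rightarrow> ennreal" where
  "typical_in_degree L E =
     emeasure (count_space UNIV) {x \<in> L. (x, 0) \<in> iS_graph (insert 0 L) E}"

definition typical_voronoi_cell :: "(real ^ 2) set \<Rightarrow> (real ^ 2) set" where
  "typical_voronoi_cell P = {y. \<forall>p\<in>P. norm y < norm (y - p)}"

end

theory Submission
  imports Defs
begin

text \<open>
  The in-neighbours of the origin are the points of \<open>L\<close>, other than \<open>0\<close>, in the Voronoi cell \<open>C E\<close>
  of the origin with respect to the eavesdroppers.  Given \<open>E\<close>, their number has mean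
  \<open>lamL * area (C E)\<close> and vanishes with probability \<open>exp (- lamL * area (C E))\<close>.
  Since \<open>y\<close> lies in \<open>C E\<close> iff \<open>E\<close> misses the disc of radius \<open>norm y\<close> about \<open>y\<close>, the mean area is
  the integral of \<open>exp (- lamE * pi * norm y ^ 2)\<close> over the plane, which is \<open>1 / lamE\<close>.  Scaling \<open>E\<close> by
  \<open>sqrt lamE\<close> gives the void probabilities of the unit-density process and multiplies the area by
  \<open>lamE\<close>.  Measurability comes from exhausting \<open>C E\<close> by the grid cells
  for which a slightly enlarged disc about the centre contains no point of \<open>E\<close>.
\<close>

section \<open>Configurations, counting events and void events\<close>

lemma locally_finite_setsD:
  "X \<in> locally_finite_sets \<Longrightarrow> bounded B \<Longrightarrow> finite (X \<inter> B)"
  by (simp add: locally_finite_sets_def)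

lemma space_config_space [simp]: "space config_space = locally_finite_sets"
  unfolding config_space_def by (rule space_measure_of) auto

lemma measurable_count_config_space:
  assumes "B \<in> sets borel" "bounded B"
  shows "(\<lambda>X. card (X \<inter> B)) \<in> measurable config_space (count_space UNIV)"
proof (rule measurableI)
  fix A :: "nat set"
  have "(\<lambda>X. card (X \<inter> B)) -` A \<inter> space config_space =
      (\<Union>n\<in>A. {X \<in> locally_finite_sets. card (X \<inter> B) = n})"
    by auto
  also have "\<dots> \<in> sets config_space"
    using assms unfolding config_space_def
    by (intro sets.countable_UN'') (auto simp: sets_measure_of)
  finally show "(\<lambda>X. card (X \<inter> B)) -` A \<inter> space config_space \<in> sets config_space" .
qed simp

text \<open>
  The void events already determine the Voronoi cell, and unlike the counting events they are
  stable under intersection; so the law of the cell is determined by void probabilities alone.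
\<close>

definition void_space :: "(real ^ 2) set measure" where
  "void_space = sigma locally_finite_sets
     {{X \<in> locally_finite_sets. X \<inter> B = {}} | B. B \<in> sets borel \<and> bounded B}"

lemma space_void_space [simp]: "space void_space = locally_finite_sets"
  unfolding void_space_def by (rule space_measure_of) auto

lemma void_event_in_sets [measurable]:
  assumes "B \<in> sets borel" "bounded B"
  shows "{X \<in> locally_finite_sets. X \<inter> B = {}} \<in> sets void_space"
  using assms unfolding void_space_def by (subst sets_measure_of) auto

text \<open>A void event is a counting event with count 0: boundedness makes
  \<open>X \<inter> B\<close> finite, so \<open>card\<close> is 0 only for the empty set. Thus
  \<open>void_space\<close> is coarser than \<open>config_space\<close>, and measurability on it
  transfers.\<close>

lemma measurable_ident_void_space [measurable]: "(\<lambda>X. X) \<in> measurable config_space void_space"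
  unfolding void_space_def
proof (rule measurable_measure_of)
  fix A assume "A \<in> {{X \<in> locally_finite_sets. X \<inter> B = {}} | B. B \<in> sets borel \<and> bounded B}"
  then obtain B where B: "B \<in> sets borel" "bounded B"
    and A: "A = {X \<in> locally_finite_sets. X \<inter> B = {}}"
    by blast
  have "(\<lambda>X. X) -` A \<inter> space config_space =
      (\<lambda>X. card (X \<inter> B)) -` {0} \<inter> space config_space"
    using B(2) unfolding A by (auto simp: locally_finite_setsD)
  also have "\<dots> \<in> sets config_space"
    by (rule measurable_sets[OF measurable_count_config_space[OF B]]) simp
  finally show "(\<lambda>X. X) -` A \<inter> space config_space \<in> sets config_space" .
qed auto

section \<open>Grid approximation of the Voronoi cell\<close>

text \<open>Integer coordinates in the grid of half-open squares of side \<open>1 / (k + 1)\<close>;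
  \<open>Suc k\<close> makes every \<open>k\<close> a valid mesh.\<close>

definition cell_index :: "nat \<Rightarrow> real ^ 2 \<Rightarrow> 2 \<Rightarrow> int" where
  "cell_index k y = (\<lambda>j. \<lfloor>real (Suc k) * y $ j\<rfloor>)"

text \<open>Squares are numbered by \<open>to_nat\<close> so that unions and sums over the grid run
  over \<open>nat\<close>; an \<open>i\<close> that codes no index function gives the empty
  cell.\<close>

definition cell :: "nat \<Rightarrow> nat \<Rightarrow> (real ^ 2) set" where
  "cell k i = {y. to_nat (cell_index k y) = i}"

text \<open>For a nonempty cell this is the corner with the least coordinates, not the midpoint;
  only its closeness to the points of the cell matters.\<close>

definition centre :: "nat \<Rightarrow> nat \<Rightarrow> real ^ 2" where
  "centre k i = (\<chi> j. of_int ((from_nat i :: 2 \<Rightarrow> int) j) / real (Suc k))"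

text \<open>
  A point \<open>y\<close> of the cell is within \<open>2 / (k + 1)\<close> of the centre, so an eavesdropper outside the
  guard ball is at distance more than \<open>norm y\<close> from \<open>y\<close>.
\<close>

definition guard :: "nat \<Rightarrow> nat \<Rightarrow> (real ^ 2) set" where
  "guard k i = cball (centre k i) (norm (centre k i) + 4 / real (Suc k))"

text \<open>An inner approximation of the Voronoi cell that depends on \<open>e\<close> only through
  countably many void events.\<close>

definition inner_cells :: "nat \<Rightarrow> (real ^ 2) set \<Rightarrow> (real ^ 2) set" where
  "inner_cells k e = (\<Union>i\<in>{i. e \<inter> guard k i = {}}. cell k i)"

text \<open>Rounding down moves each coordinate by at most \<open>1 / (k + 1)\<close>, and the
  Euclidean norm is at most the sum of the two coordinate errors.\<close>

lemma dist_centre: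
  assumes "y \<in> cell k i"
  shows "dist (centre k i) y \<le> 2 / real (Suc k)"
proof -
  have idx: "from_nat i = cell_index k y"
    using assms by (auto simp: cell_def)
  have "\<bar>(centre k i - y) $ j\<bar> \<le> 1 / real (Suc k)" for j
  proof -
    have "\<bar>of_int \<lfloor>real (Suc k) * y $ j\<rfloor> - real (Suc k) * y $ j\<bar> \<le> 1"
      by linarith
    moreover have "(centre k i - y) $ j =
        (of_int \<lfloor>real (Suc k) * y $ j\<rfloor> - real (Suc k) * y $ j) / real (Suc k)"
      unfolding centre_def idx by (simp add: cell_index_def diff_divide_distrib del: of_nat_Suc)
    ultimately show ?thesis
      by (simp add: divide_right_mono del: of_nat_Suc)
  qed
  then have "norm (centre k i - y) \<le> (\<Sum>j\<in>(UNIV::2 set). 1 / real (Suc k))"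
    by (intro order_trans[OF norm_le_l1_cart] sum_mono)
  then show ?thesis
    by (simp add: dist_norm)
qed

lemma bounded_cell: "bounded (cell k i)"
  by (rule bounded_subset[OF bounded_cball]) (auto intro: dist_centre)

lemma borel_cell [measurable]: "cell k i \<in> sets borel"
proof -
  have "{y. cell_index k y = f} = (\<Inter>j\<in>UNIV. {y \<in> space borel. \<lfloor>real (Suc k) * y $ j\<rfloor> = f j})" for f
    by (auto simp: cell_index_def)
  moreover have "(\<Inter>j\<in>UNIV. {y \<in> space (borel :: (real ^ 2) measure). \<lfloor>real (Suc k) * y $ j\<rfloor> = f j}) \<in> sets borel"
    for f :: "2 \<Rightarrow> int"
    by (intro sets.finite_INT) (auto simp del: of_nat_Suc)
  ultimately have meas: "{y. cell_index k y = f} \<in> sets borel" for f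
    by simp
  have "cell k i = (\<Union>f\<in>{f. to_nat f = i}. {y. cell_index k y = f})"
    by (auto simp: cell_def)
  then show ?thesis
    using meas by (auto intro!: sets.countable_UN'')
qed

lemma Un_cell: "(\<Union>i. cell k i) = UNIV"
  by (auto simp: cell_def)

lemma disjoint_family_cell: "disjoint_family (cell k)"
  by (auto simp: disjoint_family_on_def cell_def)

lemma borel_guard: "guard k i \<in> sets borel"
  and bounded_guard: "bounded (guard k i)"
  by (auto simp: guard_def)

lemma inner_cells_subset: "inner_cells k e \<subseteq> typical_voronoi_cell e"
proof
  fix y assume "y \<in> inner_cells k e"
  then obtain i where y: "y \<in> cell k i" and e: "e \<inter> guard k i = {}"
    by (auto simp: inner_cells_def)
  \<comment> \<open>The guard radius exceeds \<open>norm (centre k i)\<close> by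
    \<open>2 * r\<close>: one \<open>r\<close> covers replacing the centre by \<open>y\<close> in
    the norm, the other replacing it in the distance to \<open>p\<close>.\<close>
  define r where "r = 2 / real (Suc k)"
  have guard: "guard k i = cball (centre k i) (norm (centre k i) + 2 * r)"
    by (simp add: guard_def r_def)
  have d: "norm (centre k i - y) \<le> r"
    using dist_centre[OF y] by (simp add: r_def dist_norm)
  have "norm y < norm (y - p)" if "p \<in> e" for p
  proof -
    have "norm (centre k i) + 2 * r < norm (centre k i - p)"
      using that e by (auto simp: guard dist_norm)
    moreover have "norm (centre k i - p) \<le> norm (centre k i - y) + norm (y - p)"
      using norm_triangle_ineq[of "centre k i - y" "y - p"] by simp
    moreover have "norm y \<le> norm (centre k i) + norm (centre k i - y)"
      using norm_triangle_ineq4[of "centre k i" "centre k i - y"] by simp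
    ultimately show ?thesis using d by linarith
  qed
  then show "y \<in> typical_voronoi_cell e"
    by (simp add: typical_voronoi_cell_def)
qed

text \<open>Local finiteness makes the strict inequalities uniform: only finitely many points lie
  within \<open>norm y + 1\<close> of \<open>y\<close>, and all others have margin at least
  1.\<close>

lemma locally_finite_gap:
  assumes e: "e \<in> locally_finite_sets" and y: "y \<in> typical_voronoi_cell e"
  obtains d where "d > 0" "\<And>p. p \<in> e \<Longrightarrow> norm y + d \<le> norm (y - p)"
proof -
  define S where "S = (\<lambda>p. norm (y - p) - norm y) ` (e \<inter> cball y (norm y + 1))"
  \<comment> \<open>The extra 1 keeps \<open>Min\<close> defined when no point is near and caps the
    margin at what the far points provide.\<close>
  have S: "finite (insert 1 S)"
    using locally_finite_setsD[OF e] by (simp add: S_def)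
  have pos: "s > 0" if "s \<in> insert 1 S" for s
    using that y by (auto simp: S_def typical_voronoi_cell_def)
  show thesis
  proof (rule that)
    show "Min (insert 1 S) > 0"
      using S pos by (subst Min_gr_iff) auto
    fix p assume p: "p \<in> e"
    show "norm y + Min (insert 1 S) \<le> norm (y - p)"
    proof (cases "p \<in> cball y (norm y + 1)")
      case True
      then have "Min (insert 1 S) \<le> norm (y - p) - norm y"
        using p S by (intro Min_le) (auto simp: S_def)
      then show ?thesis by simp
    next
      case False
      moreover have "Min (insert 1 S) \<le> 1" using S by (intro Min_le) auto
      ultimately show ?thesis by (simp add: dist_norm)
    qed
  qed
qed

lemma eventually_inner_cells:
  assumes e: "e \<in> locally_finite_sets" and y: "y \<in> typical_voronoi_cell e"
  shows "eventually (\<lambda>k. y \<in> inner_cells k e) sequentially"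
proof -
  obtain d where d: "d > 0" "\<And>p. p \<in> e \<Longrightarrow> norm y + d \<le> norm (y - p)"
    using locally_finite_gap[OF e y] by blast
  have "(\<lambda>k. 8 / real (Suc k)) \<longlonglongrightarrow> 0"
    by (intro LIMSEQ_Suc lim_const_over_n)
  \<comment> \<open>This is \<open>4 * r < d\<close> with \<open>r\<close> as before: the guard ball
    contributes \<open>2 * r\<close>, and passing between the centre and \<open>y\<close> costs one
    \<open>r\<close> in the norm and one in the distance.\<close>
  then have "eventually (\<lambda>k. 8 / real (Suc k) < d) sequentially"
    using d(1) by (auto dest: order_tendstoD)
  then show ?thesis
  proof (rule eventually_mono)
    fix k assume "8 / real (Suc k) < d"
    moreover define r where "r = 2 / real (Suc k)"
    ultimately have kd: "4 * r < d" by simp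
    obtain i where i: "y \<in> cell k i" using Un_cell[of k] by auto
    have guard: "guard k i = cball (centre k i) (norm (centre k i) + 2 * r)"
      by (simp add: guard_def r_def)
    have dc: "norm (centre k i - y) \<le> r"
      using dist_centre[OF i] by (simp add: r_def dist_norm)
    have "p \<notin> guard k i" if "p \<in> e" for p
    proof -
      have "norm (centre k i) \<le> norm y + norm (centre k i - y)"
        using norm_triangle_ineq[of y "centre k i - y"] by simp
      moreover have "norm (y - p) \<le> norm (centre k i - y) + norm (centre k i - p)"
        using norm_triangle_ineq4[of "centre k i - p" "centre k i - y"] by simp
      ultimately show ?thesis
        using d(2)[OF that] dc kd by (simp add: guard dist_norm)
    qed
    then show "y \<in> inner_cells k e"
      using i by (auto simp: inner_cells_def)
  qed
qed

lemma Un_inner_cells: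
  assumes "e \<in> locally_finite_sets"
  shows "(\<Union>k. inner_cells k e) = typical_voronoi_cell e"
  using inner_cells_subset eventually_inner_cells[OF assms]
  by (fastforce simp: eventually_sequentially)

lemma borel_inner_cells: "inner_cells k e \<in> sets borel"
  unfolding inner_cells_def by (intro sets.countable_UN'') auto

lemma borel_typical_voronoi_cell:
  assumes "e \<in> locally_finite_sets"
  shows "typical_voronoi_cell e \<in> sets borel"
  unfolding Un_inner_cells[OF assms, symmetric] by (auto intro: borel_inner_cells)

section \<open>The in-degree and the cell area as measurable functions\<close>

lemma typical_in_degree_eq:
  "typical_in_degree l e = emeasure (count_space UNIV) (l \<inter> (typical_voronoi_cell e - {0}))"
proof -
  have "{x \<in> l. (x, 0) \<in> iS_graph (insert 0 l) e} = l \<inter> (typical_voronoi_cell e - {0})"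
    by (auto simp: iS_graph_def typical_voronoi_cell_def dist_norm)
  then show ?thesis
    by (simp add: typical_in_degree_def)
qed

text \<open>Grids of successive meshes are not nested, so continuity from below is applied to the
  tail intersections \<open>W k\<close>. These increase, and since each point of the Voronoi cell is
  eventually in every \<open>inner_cells k e\<close>, they exhaust it.\<close>

lemma SUP_count_inner_cells:
  assumes e: "e \<in> locally_finite_sets"
  shows "emeasure (count_space UNIV) (A \<inter> typical_voronoi_cell e) =
    (SUP k. emeasure (count_space UNIV) (A \<inter> inner_cells k e))"
proof (rule antisym)
  define W where "W = (\<lambda>k. \<Inter>m\<in>{k..}. A \<inter> inner_cells m e)"
  have "A \<inter> typical_voronoi_cell e = (\<Union>k. W k)"
  proof
    show "A \<inter> typical_voronoi_cell e \<subseteq> (\<Union>k. W k)"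
      using eventually_inner_cells[OF e] by (fastforce simp: W_def eventually_sequentially)
    show "(\<Union>k. W k) \<subseteq> A \<inter> typical_voronoi_cell e"
      using inner_cells_subset by (force simp: W_def)
  qed
  also have "emeasure (count_space UNIV) (\<Union>k. W k) = (SUP k. emeasure (count_space UNIV) (W k))"
    by (rule SUP_emeasure_incseq[symmetric]) (auto simp: incseq_def W_def)
  also have "\<dots> \<le> (SUP k. emeasure (count_space UNIV) (A \<inter> inner_cells k e))"
    by (intro SUP_mono) (auto simp: W_def intro!: emeasure_mono)
  finally show "emeasure (count_space UNIV) (A \<inter> typical_voronoi_cell e) \<le>
    (SUP k. emeasure (count_space UNIV) (A \<inter> inner_cells k e))" .
  show "(SUP k. emeasure (count_space UNIV) (A \<inter> inner_cells k e)) \<le>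
    emeasure (count_space UNIV) (A \<inter> typical_voronoi_cell e)"
    using inner_cells_subset by (intro SUP_least emeasure_mono) auto
qed

lemma emeasure_count_space_cells:
  "emeasure (count_space UNIV) A = (\<Sum>i. emeasure (count_space UNIV) (A \<inter> cell k i))"
proof -
  have "disjoint_family (\<lambda>i. A \<inter> cell k i)"
    using disjoint_family_cell[of k] by (auto simp: disjoint_family_on_def)
  moreover have "(\<Union>i. A \<inter> cell k i) = A"
    using Un_cell[of k] by blast
  ultimately show ?thesis
    by (subst suminf_emeasure) auto
qed

text \<open>Separates the variables: each summand is a void indicator in \<open>e\<close> times a
  bounded-set count in \<open>l\<close>, so joint measurability follows from that of the factors
  through countable sums and suprema.\<close>

lemma typical_in_degree_cells:
  assumes l: "l \<in> locally_finite_sets" and e: "e \<in> locally_finite_sets"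
  shows "typical_in_degree l e =
    (SUP k. \<Sum>i. indicator {X \<in> locally_finite_sets. X \<inter> guard k i = {}} e *
       of_nat (card (l \<inter> (cell k i - {0}))))"
proof -
  have "emeasure (count_space UNIV) ((l - {0}) \<inter> inner_cells k e \<inter> cell k i) =
    indicator {X \<in> locally_finite_sets. X \<inter> guard k i = {}} e * of_nat (card (l \<inter> (cell k i - {0})))"
    for k i
  proof (cases "e \<inter> guard k i = {}")
    case True
    then have "(l - {0}) \<inter> inner_cells k e \<inter> cell k i = l \<inter> (cell k i - {0})"
      by (auto simp: inner_cells_def)
    moreover have "finite (l \<inter> (cell k i - {0}))"
      using bounded_cell by (intro locally_finite_setsD[OF l] bounded_diff)
    ultimately show ?thesis using True e by simp
  next
    case False
    then have "(l - {0}) \<inter> inner_cells k e \<inter> cell k i = {}"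
      by (auto simp: inner_cells_def cell_def)
    then show ?thesis using False by simp
  qed
  moreover have "l \<inter> (typical_voronoi_cell e - {0}) = (l - {0}) \<inter> typical_voronoi_cell e"
    by auto
  ultimately show ?thesis
    by (simp add: typical_in_degree_eq SUP_count_inner_cells[OF e]
        emeasure_count_space_cells[of "(l - {0}) \<inter> inner_cells k e" k for k])
qed

lemma measurable_typical_in_degree:
  "(\<lambda>(l, e). typical_in_degree l e) \<in> borel_measurable (config_space \<Otimes>\<^sub>M config_space)"
proof -
  have void: "{X \<in> locally_finite_sets. X \<inter> guard k i = {}} \<in> sets config_space" for k i
    using measurable_sets[OF measurable_ident_void_space
        void_event_in_sets[OF borel_guard[of k i] bounded_guard]]
    by (simp add: vimage_def Int_def conj_commute cong: conj_cong)
  have count: "(\<lambda>X. card (X \<inter> (cell k i - {0}))) \<in> measurable config_space (count_space UNIV)" for k i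
    using bounded_cell by (intro measurable_count_config_space bounded_diff) auto
  note void[measurable] count[measurable]
  have "(\<lambda>x. SUP k. \<Sum>i. indicator {X \<in> locally_finite_sets. X \<inter> guard k i = {}} (snd x) *
       of_nat (card (fst x \<inter> (cell k i - {0}))) :: ennreal)
     \<in> borel_measurable (config_space \<Otimes>\<^sub>M config_space)"
    by measurable
  then show ?thesis
    by (rule measurable_cong[THEN iffD1, rotated])
       (auto simp: typical_in_degree_cells space_pair_measure)
qed

text \<open>The grid approximation exhibits the relation as a countable union of measurable
  rectangles. Its sections in \<open>e\<close> are the Voronoi cells, which gives measurability of
  the area and allows Tonelli.\<close>

lemma voronoi_relation_in_sets:
  "{(e, y). e \<in> locally_finite_sets \<and> y \<in> typical_voronoi_cell e} \<in> sets (void_space \<Otimes>\<^sub>M lborel)"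
proof -
  have "{(e, y). e \<in> locally_finite_sets \<and> y \<in> typical_voronoi_cell e} =
    (\<Union>k. \<Union>i. {X \<in> locally_finite_sets. X \<inter> guard k i = {}} \<times> cell k i)"
    by (auto simp: Un_inner_cells[symmetric] inner_cells_def) blast
  also have "\<dots> \<in> sets (void_space \<Otimes>\<^sub>M lborel)"
    using void_event_in_sets[OF borel_guard bounded_guard]
    by (intro sets.countable_UN'' pair_measureI) auto
  finally show ?thesis .
qed

lemma measurable_cell_area [measurable]:
  "(\<lambda>e. emeasure lborel (typical_voronoi_cell e)) \<in> borel_measurable void_space"
proof -
  have "Pair e -` {(e, y). e \<in> locally_finite_sets \<and> y \<in> typical_voronoi_cell e} =
      typical_voronoi_cell e" if "e \<in> locally_finite_sets" for e
    using that by auto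
  then show ?thesis
    by (intro measurable_cong[THEN iffD1, OF _ lborel.measurable_emeasure_Pair[OF voronoi_relation_in_sets]])
       simp
qed

section \<open>Void probabilities and mean counts of a Poisson process\<close>

lemma poisson_processD:
  assumes "poisson_process M lam X"
  shows "X \<in> measurable M config_space"
    and "\<And>B n. B \<in> sets borel \<Longrightarrow> bounded B \<Longrightarrow>
      measure M {\<omega> \<in> space M. card (X \<omega> \<inter> B) = n} =
        (lam * measure lborel B) ^ n / fact n * exp (- (lam * measure lborel B))"
  using assms unfolding poisson_process_def by auto

lemma poisson_process_locally_finite:
  "poisson_process M lam X \<Longrightarrow> \<omega> \<in> space M \<Longrightarrow> X \<omega> \<in> locally_finite_sets"
  using poisson_processD(1) measurable_space[of X M config_space] by auto

lemma poisson_void_bounded: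
  assumes X: "poisson_process M lam X" and B: "B \<in> sets borel" "bounded B"
  shows "measure M {\<omega> \<in> space M. X \<omega> \<inter> B = {}} = exp (- (lam * measure lborel B))"
proof -
  have "{\<omega> \<in> space M. X \<omega> \<inter> B = {}} = {\<omega> \<in> space M. card (X \<omega> \<inter> B) = 0}"
    using locally_finite_setsD[OF poisson_process_locally_finite[OF X] B(2)] by auto
  then show ?thesis
    using poisson_processD(2)[OF X B, of 0] by simp
qed

lemma poisson_void_event_in_sets:
  assumes X: "poisson_process M lam X" and B: "B \<in> sets borel"
  shows "{\<omega> \<in> space M. X \<omega> \<inter> B = {}} \<in> sets M"
proof -
  have "{\<omega> \<in> space M. X \<omega> \<inter> (B \<inter> cball 0 (real n)) = {}} \<in> sets M" for n
  proof -
    have "B \<inter> cball 0 (real n) \<in> sets borel" "bounded (B \<inter> cball 0 (real n))"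
      using B by (auto intro: bounded_subset)
    from measurable_sets[OF measurable_compose[OF poisson_processD(1)[OF X] measurable_ident_void_space]
        void_event_in_sets[OF this]]
    show ?thesis
      using poisson_process_locally_finite[OF X]
      by (simp add: vimage_def Int_def[of _ "space M"] conj_commute cong: conj_cong)
  qed
  then have "(\<Inter>n. {\<omega> \<in> space M. X \<omega> \<inter> (B \<inter> cball 0 (real n)) = {}}) \<in> sets M"
    by (intro sets.countable_INT) auto
  also have "(\<Inter>n. {\<omega> \<in> space M. X \<omega> \<inter> (B \<inter> cball 0 (real n)) = {}}) =
      {\<omega> \<in> space M. X \<omega> \<inter> B = {}}"
    using real_arch_simple by (fastforce simp: set_eq_iff)
  finally show ?thesis .
qed

text \<open>A Voronoi cell may be unbounded while having finite area, so the void formula is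
  extended from bounded sets: along \<open>B \<inter> cball 0 n\<close> the void events decrease and
  the areas increase to their limits.\<close>

lemma poisson_void:
  assumes M: "prob_space M" and X: "poisson_process M lam X"
    and B: "B \<in> sets borel" "emeasure lborel B \<noteq> \<infinity>"
  shows "measure M {\<omega> \<in> space M. X \<omega> \<inter> B = {}} = exp (- (lam * measure lborel B))"
proof -
  interpret prob_space M by fact
  define C where "C = (\<lambda>n. B \<inter> cball 0 (real n))"
  have C: "C n \<in> sets borel" "bounded (C n)" for n
    using B(1) by (auto simp: C_def intro: bounded_subset)
  have UnC: "(\<Union>n. C n) = B"
    using real_arch_simple by (fastforce simp: C_def)
  have incC: "incseq C"
    unfolding incseq_def C_def by (auto intro: order_trans)
  have "(\<lambda>n. measure M {\<omega> \<in> space M. X \<omega> \<inter> C n = {}}) \<longlonglongrightarrow>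
      measure M (\<Inter>n. {\<omega> \<in> space M. X \<omega> \<inter> C n = {}})"
    using poisson_void_event_in_sets[OF X C(1)] incC
    by (intro finite_Lim_measure_decseq) (auto simp: decseq_def incseq_def, blast)
  also have "(\<Inter>n. {\<omega> \<in> space M. X \<omega> \<inter> C n = {}}) = {\<omega> \<in> space M. X \<omega> \<inter> B = {}}"
    unfolding UnC[symmetric] by auto
  finally have "(\<lambda>n. exp (- (lam * measure lborel (C n)))) \<longlonglongrightarrow>
      measure M {\<omega> \<in> space M. X \<omega> \<inter> B = {}}"
    by (simp add: poisson_void_bounded[OF X C])
  moreover have "(\<lambda>n. exp (- (lam * measure lborel (C n)))) \<longlonglongrightarrow> exp (- (lam * measure lborel B))"
  proof -
    have "(\<lambda>n. measure lborel (C n)) \<longlonglongrightarrow> measure lborel (\<Union>n. C n)"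
      using C(1) incC B(2) by (intro Lim_measure_incseq) (auto simp: UnC)
    then show ?thesis
      unfolding UnC by (intro tendsto_intros)
  qed
  ultimately show ?thesis
    by (rule LIMSEQ_unique)
qed

text \<open>The term at 0 vanishes, and the term at \<open>n + 1\<close> is
  \<open>x * exp (- x)\<close> times the \<open>n\<close>-th term of the exponential series.\<close>

lemma poisson_mean_sums:
  "(\<lambda>n. real n * (x ^ n / fact n * exp (- x))) sums x" for x :: real
proof -
  have "(\<lambda>n. x * exp (- x) * (x ^ n /\<^sub>R fact n)) sums (x * exp (- x) * exp x)"
    by (intro sums_mult exp_converges)
  also have "(\<lambda>n. x * exp (- x) * (x ^ n /\<^sub>R fact n)) =
      (\<lambda>n. real (Suc n) * (x ^ Suc n / fact (Suc n) * exp (- x)))"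
  proof
    fix n
    have "real (Suc n) / fact (Suc n) = 1 / fact n"
      by (simp add: fact_Suc del: of_nat_Suc)
    then show "x * exp (- x) * (x ^ n /\<^sub>R fact n) =
        real (Suc n) * (x ^ Suc n / fact (Suc n) * exp (- x))"
      by (simp add: divide_inverse mult_ac)
  qed
  also have "x * exp (- x) * exp x = x"
    by (simp add: exp_minus)
  finally show ?thesis
    by (subst (asm) sums_Suc_iff) simp
qed

lemma poisson_mean_bounded:
  assumes M: "prob_space M" and X: "poisson_process M lam X" and lam: "lam \<ge> 0"
    and B: "B \<in> sets borel" "bounded B"
  shows "(\<integral>\<^sup>+\<omega>. of_nat (card (X \<omega> \<inter> B)) \<partial>M) = ennreal (lam * measure lborel B)"
proof -
  interpret prob_space M by fact
  define x where "x = lam * measure lborel B"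
  have x: "x \<ge> 0" using lam by (simp add: x_def)
  have Y: "(\<lambda>\<omega>. card (X \<omega> \<inter> B)) \<in> measurable M (count_space UNIV)"
    by (rule measurable_compose[OF poisson_processD(1)[OF X] measurable_count_config_space[OF B]])
  have distr: "distr M (count_space UNIV) (\<lambda>\<omega>. card (X \<omega> \<inter> B)) =
      density (count_space UNIV) (\<lambda>n. ennreal (x ^ n / fact n * exp (- x)))"
  proof (rule measure_eqI_countable[where A = UNIV])
    fix n
    have "emeasure (distr M (count_space UNIV) (\<lambda>\<omega>. card (X \<omega> \<inter> B))) {n} =
        emeasure M {\<omega> \<in> space M. card (X \<omega> \<inter> B) = n}"
      by (subst emeasure_distr[OF Y]) (auto simp: vimage_def Int_def conj_commute)
    also have "\<dots> = ennreal (x ^ n / fact n * exp (- x))"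
      using poisson_processD(2)[OF X B, of n] by (simp add: emeasure_eq_measure x_def)
    finally show "emeasure (distr M (count_space UNIV) (\<lambda>\<omega>. card (X \<omega> \<inter> B))) {n} =
        emeasure (density (count_space UNIV) (\<lambda>n. ennreal (x ^ n / fact n * exp (- x)))) {n}"
      by (simp add: emeasure_density nn_integral_count_space_indicator[symmetric])
  qed auto
  have "(\<integral>\<^sup>+\<omega>. of_nat (card (X \<omega> \<inter> B)) \<partial>M) =
      (\<integral>\<^sup>+n. of_nat n \<partial>distr M (count_space UNIV) (\<lambda>\<omega>. card (X \<omega> \<inter> B)))"
    using Y by (subst nn_integral_distr) auto
  also have "\<dots> = (\<Sum>n. ennreal (real n * (x ^ n / fact n * exp (- x))))"
    unfolding distr using x
    by (simp add: nn_integral_density nn_integral_count_space_nat ennreal_mult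
        ennreal_of_nat_eq_real_of_nat mult.commute del: times_divide_eq_left times_divide_eq_right)
  also have "\<dots> = ennreal x"
    using x by (intro suminf_ennreal_eq poisson_mean_sums) auto
  finally show ?thesis by (simp add: x_def)
qed

text \<open>Linearity over the unit squares of the grid reduces to bounded sets. Counting measure
  and \<open>emeasure\<close> let both sides be infinite.\<close>

lemma poisson_mean:
  assumes M: "prob_space M" and X: "poisson_process M lam X" and lam: "lam \<ge> 0"
    and B: "B \<in> sets borel"
  shows "(\<integral>\<^sup>+\<omega>. emeasure (count_space UNIV) (X \<omega> \<inter> B) \<partial>M) = ennreal lam * emeasure lborel B"
proof -
  interpret prob_space M by fact
  define C where "C = (\<lambda>i. B \<inter> cell 0 i)"
  have C: "C i \<in> sets borel" "bounded (C i)" for i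
    using B bounded_cell by (auto simp: C_def)
  have count: "emeasure (count_space UNIV) (X \<omega> \<inter> B) = (\<Sum>i. of_nat (card (X \<omega> \<inter> C i)))"
    if "\<omega> \<in> space M" for \<omega>
    using locally_finite_setsD[OF poisson_process_locally_finite[OF X that] C(2)]
    by (subst emeasure_count_space_cells[of _ 0]) (simp add: C_def Int_assoc)
  have [measurable]: "(\<lambda>\<omega>. card (X \<omega> \<inter> C i)) \<in> measurable M (count_space UNIV)" for i
    by (rule measurable_compose[OF poisson_processD(1)[OF X] measurable_count_config_space[OF C]])
  have "(\<integral>\<^sup>+\<omega>. emeasure (count_space UNIV) (X \<omega> \<inter> B) \<partial>M) =
      (\<integral>\<^sup>+\<omega>. (\<Sum>i. of_nat (card (X \<omega> \<inter> C i))) \<partial>M)"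
    by (rule nn_integral_cong) (rule count)
  also have "\<dots> = (\<Sum>i. \<integral>\<^sup>+\<omega>. of_nat (card (X \<omega> \<inter> C i)) \<partial>M)"
    by (rule nn_integral_suminf) measurable
  also have "\<dots> = (\<Sum>i. ennreal lam * emeasure lborel (C i))"
  proof (rule suminf_cong)
    fix i
    have "emeasure lborel (C i) = ennreal (measure lborel (C i))"
      using emeasure_bounded_finite[OF C(2)[of i]] by (intro emeasure_eq_ennreal_measure) auto
    then show "(\<integral>\<^sup>+\<omega>. of_nat (card (X \<omega> \<inter> C i)) \<partial>M) = ennreal lam * emeasure lborel (C i)"
      using poisson_mean_bounded[OF M X lam C] lam by (simp add: ennreal_mult)
  qed
  also have "\<dots> = ennreal lam * emeasure lborel (\<Union>i. C i)"
    using C(1) disjoint_family_cell[of 0]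
    by (subst ennreal_suminf_cmult, subst suminf_emeasure) (auto simp: C_def disjoint_family_on_def)
  also have "(\<Union>i. C i) = B"
    using Un_cell[of 0] by (auto simp: C_def)
  finally show ?thesis .
qed

section \<open>Uniqueness from void probabilities, and scaling\<close>

text \<open>Void events form a generating \<pi>-system: missing \<open>A\<close> and missing
  \<open>B\<close> is missing \<open>A \<union> B\<close>. The empty test set gives the whole space,
  where the measures are finite.\<close>

lemma void_law_unique:
  assumes "finite_measure N" and N: "sets N = sets void_space" and N': "sets N' = sets void_space"
    and eq: "\<And>B. B \<in> sets borel \<Longrightarrow> bounded B \<Longrightarrow>
      emeasure N {X \<in> locally_finite_sets. X \<inter> B = {}} = emeasure N' {X \<in> locally_finite_sets. X \<inter> B = {}}"
  shows "N = N'"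
proof -
  interpret finite_measure N by fact
  define G :: "(real ^ 2) set set set" where
    "G = {{X \<in> locally_finite_sets. X \<inter> B = {}} | B. B \<in> sets borel \<and> bounded B}"
  have void: "{X \<in> locally_finite_sets. X \<inter> B = {}} \<in> G" if "B \<in> sets borel" "bounded B" for B
    using that unfolding G_def by blast
  have sets: "sets void_space = sigma_sets locally_finite_sets G"
    unfolding void_space_def G_def by (rule sets_measure_of) auto
  show ?thesis
  proof (rule measure_eqI_generator_eq[where E = G and \<Omega> = locally_finite_sets
        and A = "\<lambda>_. {X \<in> locally_finite_sets. X \<inter> {} = {}}"])
    show "Int_stable G"
    proof (rule Int_stableI)
      fix a b assume "a \<in> G" "b \<in> G"
      then obtain A B where "A \<in> sets borel" "bounded A" "B \<in> sets borel" "bounded B"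
        and "a = {X \<in> locally_finite_sets. X \<inter> A = {}}" "b = {X \<in> locally_finite_sets. X \<inter> B = {}}"
        unfolding G_def by blast
      moreover from this have "a \<inter> b = {X \<in> locally_finite_sets. X \<inter> (A \<union> B) = {}}" by auto
      ultimately show "a \<inter> b \<in> G" using void[of "A \<union> B"] by simp
    qed
    show "range (\<lambda>_. {X \<in> locally_finite_sets. X \<inter> {} = {}}) \<subseteq> G"
      using void[of "{}"] by auto
    show "\<And>X. X \<in> G \<Longrightarrow> emeasure N X = emeasure N' X"
      unfolding G_def using eq by blast
  qed (auto simp: G_def N N' sets)
qed

lemma measurable_poisson_void_space:
  "poisson_process M lam X \<Longrightarrow> X \<in> measurable M void_space"
  by (rule measurable_compose[OF poisson_processD(1) measurable_ident_void_space])

lemma locally_finite_scale: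
  assumes "X \<in> locally_finite_sets" "s \<noteq> 0"
  shows "(*\<^sub>R) s ` X \<in> locally_finite_sets"
  unfolding locally_finite_sets_def
proof safe
  fix B :: "(real ^ 2) set" assume "bounded B"
  then have "finite (X \<inter> (*\<^sub>R) (1 / s) ` B)"
    using assms(1) by (intro locally_finite_setsD bounded_scaling)
  moreover have "(*\<^sub>R) s ` X \<inter> B \<subseteq> (*\<^sub>R) s ` (X \<inter> (*\<^sub>R) (1 / s) ` B)"
    using assms(2) by (force simp: image_iff)
  ultimately show "finite ((*\<^sub>R) s ` X \<inter> B)"
    by (blast intro: finite_subset)
qed

lemma scale_disjoint_iff:
  fixes X B :: "'a::real_vector set"
  assumes "s \<noteq> 0"
  shows "(*\<^sub>R) s ` X \<inter> B = {} \<longleftrightarrow> X \<inter> (*\<^sub>R) (1 / s) ` B = {}"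
  using assms by (force simp: image_iff set_eq_iff)

lemma borel_scale:
  fixes B :: "(real ^ 2) set"
  assumes "B \<in> sets borel" "s \<noteq> 0"
  shows "(*\<^sub>R) s ` B \<in> sets borel"
proof -
  have "(*\<^sub>R) s ` B = (\<lambda>x. (1 / s) *\<^sub>R x) -` B \<inter> space borel"
    using assms(2) by (force simp: image_iff)
  also have "\<dots> \<in> sets borel"
    using assms(1) by (intro measurable_sets[of _ borel borel]) auto
  finally show ?thesis .
qed

lemma emeasure_lborel_scale:
  fixes B :: "(real ^ 2) set"
  assumes "B \<in> sets borel" "s \<noteq> 0"
  shows "emeasure lborel ((*\<^sub>R) s ` B) = ennreal (s\<^sup>2) * emeasure lborel B"
  using emeasure_lebesgue_affine[of s 0 B] borel_scale[OF assms] assms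
  by (simp add: emeasure_completion ennreal_power)

lemma measure_lborel_scale:
  fixes B :: "(real ^ 2) set"
  assumes "B \<in> sets borel" "s \<noteq> 0"
  shows "measure lborel ((*\<^sub>R) s ` B) = s\<^sup>2 * measure lborel B"
  using emeasure_lborel_scale[OF assms] by (simp add: measure_def enn2real_mult)

lemma measurable_scale_void_space:
  assumes "s \<noteq> 0"
  shows "(\<lambda>X. (*\<^sub>R) s ` X) \<in> measurable void_space void_space"
proof -
  have "(\<lambda>X. (*\<^sub>R) s ` X) \<in> measurable void_space (sigma locally_finite_sets
     {{X \<in> locally_finite_sets. X \<inter> B = {}} | B. B \<in> sets borel \<and> bounded B})"
  proof (rule measurable_measure_of)
    fix A assume "A \<in> {{X \<in> locally_finite_sets. X \<inter> B = {}} | B. B \<in> sets borel \<and> bounded B}"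
    then obtain B where B: "B \<in> sets borel" "bounded B"
      and A: "A = {X \<in> locally_finite_sets. X \<inter> B = {}}"
      by blast
    have "(\<lambda>X. (*\<^sub>R) s ` X) -` A \<inter> space void_space =
        {X \<in> locally_finite_sets. X \<inter> (*\<^sub>R) (1 / s) ` B = {}}"
      using assms locally_finite_scale by (auto simp: A scale_disjoint_iff[OF assms])
    also have "\<dots> \<in> sets void_space"
      using B assms by (intro void_event_in_sets borel_scale bounded_scaling) auto
    finally show "(\<lambda>X. (*\<^sub>R) s ` X) -` A \<inter> space void_space \<in> sets void_space" .
  qed (use assms in \<open>auto intro: locally_finite_scale\<close>)
  then show ?thesis by (simp only: void_space_def[symmetric])
qed

lemma emeasure_distr_void:
  assumes X: "X \<in> measurable M void_space" and B: "B \<in> sets borel" "bounded B"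
  shows "emeasure (distr M void_space X) {Y \<in> locally_finite_sets. Y \<inter> B = {}} =
    emeasure M {\<omega> \<in> space M. X \<omega> \<inter> B = {}}"
  using measurable_space[OF X]
  by (subst emeasure_distr[OF X void_event_in_sets[OF B]]) (auto intro!: arg_cong[of _ _ "emeasure M"])

text \<open>The scaled process misses \<open>B\<close> exactly when \<open>X\<close> misses
  \<open>B\<close> shrunk by \<open>sqrt lam\<close>, a set of area
  \<open>measure lborel B / lam\<close>; the intensity cancels. Comparing laws on
  \<open>void_space\<close> reduces the claim to this computation.\<close>

lemma poisson_scale_law:
  assumes M: "prob_space M" and M': "prob_space M'" and lam: "lam > 0"
    and X: "poisson_process M lam X" and P: "poisson_process M' 1 P"
  shows "distr M void_space (\<lambda>\<omega>. (*\<^sub>R) (sqrt lam) ` X \<omega>) = distr M' void_space P"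
proof -
  interpret M: prob_space M by fact
  interpret M': prob_space M' by fact
  have s: "sqrt lam \<noteq> 0" using lam by simp
  have meas: "(\<lambda>\<omega>. (*\<^sub>R) (sqrt lam) ` X \<omega>) \<in> measurable M void_space"
    by (rule measurable_compose[OF measurable_poisson_void_space[OF X] measurable_scale_void_space[OF s]])
  show ?thesis
  proof (rule void_law_unique)
    show "finite_measure (distr M void_space (\<lambda>\<omega>. (*\<^sub>R) (sqrt lam) ` X \<omega>))"
      using meas by (rule M.finite_measure_distr)
    fix B :: "(real ^ 2) set" assume B: "B \<in> sets borel" "bounded B"
    have sB: "(*\<^sub>R) (1 / sqrt lam) ` B \<in> sets borel" "bounded ((*\<^sub>R) (1 / sqrt lam) ` B)"
      using B s by (auto intro: borel_scale bounded_scaling)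
    have "measure M {\<omega> \<in> space M. (*\<^sub>R) (sqrt lam) ` X \<omega> \<inter> B = {}} = exp (- measure lborel B)"
      unfolding scale_disjoint_iff[OF s] poisson_void_bounded[OF X sB]
      using measure_lborel_scale[OF B(1), of "1 / sqrt lam"] lam by (simp add: power_divide)
    also have "\<dots> = measure M' {\<omega> \<in> space M'. P \<omega> \<inter> B = {}}"
      by (simp add: poisson_void_bounded[OF P B])
    finally show "emeasure (distr M void_space (\<lambda>\<omega>. (*\<^sub>R) (sqrt lam) ` X \<omega>))
        {X \<in> locally_finite_sets. X \<inter> B = {}} =
      emeasure (distr M' void_space P) {X \<in> locally_finite_sets. X \<inter> B = {}}"
      by (simp add: emeasure_distr_void[OF meas B] M.emeasure_eq_measure M'.emeasure_eq_measure
          emeasure_distr_void[OF measurable_poisson_void_space[OF P] B])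
  qed auto
qed

lemma typical_voronoi_cell_scale:
  assumes "s > 0"
  shows "typical_voronoi_cell ((*\<^sub>R) s ` X) = (*\<^sub>R) s ` typical_voronoi_cell X"
proof -
  have "y \<in> typical_voronoi_cell ((*\<^sub>R) s ` X) \<longleftrightarrow> (1 / s) *\<^sub>R y \<in> typical_voronoi_cell X" for y
  proof -
    have "norm (y - s *\<^sub>R p) = s * norm ((1 / s) *\<^sub>R y - p)" for p
    proof -
      have "y - s *\<^sub>R p = s *\<^sub>R ((1 / s) *\<^sub>R y - p)"
        using assms by (simp add: scaleR_diff_right)
      then show ?thesis using assms by (metis abs_of_pos norm_scaleR)
    qed
    then show ?thesis
      using assms by (simp add: typical_voronoi_cell_def field_simps)
  qed
  then show ?thesis
    using assms by (force simp: image_iff)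
qed

section \<open>Gaussian integrals and the mean cell area\<close>

lemma nn_integral_exp_square:
  assumes c: "c > 0"
  shows "(\<integral>\<^sup>+t. ennreal (exp (- (c * pi * t\<^sup>2))) \<partial>lborel) = ennreal (1 / sqrt c)"
proof -
  \<comment> \<open>Chosen so that the exponent of the centred normal density is
    \<open>- (c * pi * t\<^sup>2)\<close>; its normalising factor is then
    \<open>sqrt c\<close>.\<close>
  define \<sigma> where "\<sigma> = 1 / sqrt (2 * pi * c)"
  have \<sigma>: "\<sigma> > 0" "2 * \<sigma>\<^sup>2 = 1 / (pi * c)"
    using c by (simp_all add: \<sigma>_def power_divide)
  have var: "2 * pi * \<sigma>\<^sup>2 = 1 / c"
    using c by (simp add: \<sigma>_def power_divide)
  have dens: "exp (- (c * pi * t\<^sup>2)) = 1 / sqrt c * normal_density 0 \<sigma> t" for t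
    unfolding normal_density_def var \<sigma>(2) using c
    by (simp add: real_sqrt_divide mult_ac)
  have "(\<integral>\<^sup>+t. ennreal (normal_density 0 \<sigma> t) \<partial>lborel) = 1"
    using \<sigma>(1) by (subst nn_integral_eq_integral) auto
  then show ?thesis
    using c unfolding dens by (simp add: ennreal_mult nn_integral_cmult del: times_divide_eq_left)
qed

text \<open>The integrand factors over the two coordinates, each contributing
  \<open>1 / sqrt c\<close>.\<close>

lemma nn_integral_gaussian_plane:
  assumes c: "c > 0"
  shows "(\<integral>\<^sup>+y. ennreal (exp (- (c * (pi * (norm y)\<^sup>2)))) \<partial>(lborel :: (real ^ 2) measure)) = ennreal (1 / c)"
proof -
  have "exp (- (c * (pi * (norm y)\<^sup>2))) = (\<Prod>b\<in>Basis. exp (- (c * pi * (y \<bullet> b)\<^sup>2)))" for y :: "real ^ 2"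
  proof -
    have "(norm y)\<^sup>2 = (\<Sum>b\<in>Basis. (y \<bullet> b)\<^sup>2)"
      unfolding power2_norm_eq_inner by (subst euclidean_inner) (simp add: power2_eq_square)
    then show ?thesis
      by (simp add: exp_sum[symmetric] sum_negf sum_distrib_left mult.assoc)
  qed
  then have "(\<integral>\<^sup>+y. ennreal (exp (- (c * (pi * (norm y)\<^sup>2)))) \<partial>(lborel :: (real ^ 2) measure)) =
      (\<integral>\<^sup>+y. (\<Prod>b\<in>Basis. ennreal (exp (- (c * pi * (y \<bullet> b)\<^sup>2)))) \<partial>(lborel :: (real ^ 2) measure))"
    by (simp add: prod_ennreal)
  also have "\<dots> = (\<Prod>b\<in>(Basis :: (real ^ 2) set). \<integral>\<^sup>+t. ennreal (exp (- (c * pi * t\<^sup>2))) \<partial>lborel)"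
    by (rule nn_integral_lborel_prod) auto
  also have "\<dots> = ennreal (1 / c)"
    using c by (simp add: nn_integral_exp_square ennreal_power power_divide)
  finally show ?thesis .
qed

lemma mean_cell_area:
  assumes M: "prob_space M" and X: "poisson_process M lam X" and lam: "lam > 0"
  shows "(\<integral>\<^sup>+\<omega>. emeasure lborel (typical_voronoi_cell (X \<omega>)) \<partial>M) = ennreal (1 / lam)"
proof -
  interpret prob_space M by fact
  note meas[measurable] = measurable_poisson_void_space[OF X]
  define D where "D = distr M void_space X"
  interpret D: prob_space D
    unfolding D_def using meas by (rule prob_space_distr)
  interpret pair_sigma_finite D lborel ..
  define Q where "Q = {(e, y). e \<in> locally_finite_sets \<and> y \<in> typical_voronoi_cell e}"
  have Q: "Q \<in> sets (D \<Otimes>\<^sub>M lborel)"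
    using voronoi_relation_in_sets unfolding Q_def
    by (simp add: D_def cong: sets_pair_measure_cong)
  have "(\<integral>\<^sup>+\<omega>. emeasure lborel (typical_voronoi_cell (X \<omega>)) \<partial>M) =
      (\<integral>\<^sup>+e. emeasure lborel (typical_voronoi_cell e) \<partial>D)"
    unfolding D_def by (subst nn_integral_distr) auto
  also have "\<dots> = (\<integral>\<^sup>+e. emeasure lborel (Pair e -` Q) \<partial>D)"
    by (intro nn_integral_cong arg_cong[of _ _ "emeasure lborel"]) (auto simp: D_def Q_def)
  also have "\<dots> = (\<integral>\<^sup>+y. emeasure D ((\<lambda>e. (e, y)) -` Q) \<partial>lborel)"
    \<comment> \<open>Tonelli: both iterated integrals equal the product measure of
      \<open>Q\<close>.\<close>
    using lborel.emeasure_pair_measure_alt[OF Q] emeasure_pair_measure_alt2[OF Q] by simp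
  also have "\<dots> = (\<integral>\<^sup>+y. ennreal (exp (- (lam * (pi * (norm y)\<^sup>2)))) \<partial>(lborel :: (real ^ 2) measure))"
  proof (rule nn_integral_cong)
    fix y :: "real ^ 2"
    \<comment> \<open>The disc is closed because membership in the Voronoi cell requires strict
      inequality.\<close>
    have "(\<lambda>e. (e, y)) -` Q = {e \<in> locally_finite_sets. e \<inter> cball y (norm y) = {}}"
      by (auto simp: Q_def typical_voronoi_cell_def dist_norm not_le[symmetric])
    then have "emeasure D ((\<lambda>e. (e, y)) -` Q) = emeasure M {\<omega> \<in> space M. X \<omega> \<inter> cball y (norm y) = {}}"
      unfolding D_def by (simp add: emeasure_distr_void[OF meas])
    also have "\<dots> = ennreal (exp (- (lam * (pi * (norm y)\<^sup>2))))"
      using poisson_void_bounded[OF X, of "cball y (norm y)"]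
      by (simp add: emeasure_eq_measure content_cball unit_ball_vol_2)
    finally show "emeasure D ((\<lambda>e. (e, y)) -` Q) = ennreal (exp (- (lam * (pi * (norm y)\<^sup>2))))" .
  qed
  also have "\<dots> = ennreal (1 / lam)"
    by (rule nn_integral_gaussian_plane[OF lam])
  finally show ?thesis .
qed

section \<open>Conditioning on the eavesdroppers\<close>

text \<open>Independence makes the joint law a product, so Tonelli permits integrating over
  \<open>X\<close> with the value of \<open>Y\<close> held fixed.\<close>

lemma nn_integral_indep_pair:
  assumes M: "prob_space M" and ind: "prob_space.indep_var M S X T Y"
    and f: "(\<lambda>(x, y). f x y) \<in> borel_measurable (S \<Otimes>\<^sub>M T)"
  shows "(\<integral>\<^sup>+\<omega>. f (X \<omega>) (Y \<omega>) \<partial>M) = (\<integral>\<^sup>+\<omega>'. \<integral>\<^sup>+\<omega>. f (X \<omega>) (Y \<omega>') \<partial>M \<partial>M)"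
proof -
  interpret prob_space M by fact
  have X[measurable]: "X \<in> measurable M S" and Y[measurable]: "Y \<in> measurable M T"
    and joint: "distr M S X \<Otimes>\<^sub>M distr M T Y = distr M (S \<Otimes>\<^sub>M T) (\<lambda>x. (X x, Y x))"
    using ind by (auto simp: indep_var_distribution_eq)
  interpret X: prob_space "distr M S X" by (rule prob_space_distr[OF X])
  interpret Y: prob_space "distr M T Y" by (rule prob_space_distr[OF Y])
  interpret pair_sigma_finite "distr M S X" "distr M T Y" ..
  note f[measurable]
  have "(\<integral>\<^sup>+\<omega>. f (X \<omega>) (Y \<omega>) \<partial>M) =
      (\<integral>\<^sup>+z. (\<lambda>(x, y). f x y) z \<partial>distr M (S \<Otimes>\<^sub>M T) (\<lambda>x. (X x, Y x)))"
    by (subst nn_integral_distr) (use f in auto)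
  also have "\<dots> = (\<integral>\<^sup>+y. \<integral>\<^sup>+x. f x y \<partial>distr M S X \<partial>distr M T Y)"
    unfolding joint[symmetric] using f by (subst nn_integral_snd[symmetric]) auto
  also have "\<dots> = (\<integral>\<^sup>+\<omega>'. \<integral>\<^sup>+x. f x (Y \<omega>') \<partial>distr M S X \<partial>M)"
    by (subst nn_integral_distr) auto
  also have "\<dots> = (\<integral>\<^sup>+\<omega>'. \<integral>\<^sup>+\<omega>. f (X \<omega>) (Y \<omega>') \<partial>M \<partial>M)"
    using measurable_space[OF Y] by (intro nn_integral_cong, subst nn_integral_distr) auto
  finally show ?thesis .
qed

lemma measurable_exp_cell_area [measurable]:
  "(\<lambda>e. exp (c * measure lborel (typical_voronoi_cell e))) \<in> borel_measurable void_space"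
  unfolding measure_def by measurable

theorem corollary3p1:
  fixes M :: "'a measure" and M' :: "'b measure"
    and L E :: "'a \<Rightarrow> (real ^ 2) set" and P :: "'b \<Rightarrow> (real ^ 2) set"
    and lamL lamE :: real
  assumes "prob_space M" and "prob_space M'"
    and "lamL > 0" and "lamE > 0"
    and "poisson_process M lamL L" and "poisson_process M lamE E"
    and "prob_space.indep_var M config_space L config_space E"
    and "poisson_process M' 1 P"
  shows "(\<lambda>\<omega>. typical_in_degree (L \<omega>) (E \<omega>)) \<in> borel_measurable M \<and>
    (\<integral>\<^sup>+ \<omega>. typical_in_degree (L \<omega>) (E \<omega>) \<partial>M) = ennreal (lamL / lamE) \<and>
    measure M {\<omega> \<in> space M. typical_in_degree (L \<omega>) (E \<omega>) = 0} =
      (\<integral>\<omega>. exp (- (lamL / lamE) * measure lborel (typical_voronoi_cell (P \<omega>))) \<partial>M')"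
proof (intro conjI)
  interpret prob_space M by fact
  note L = \<open>poisson_process M lamL L\<close> and E = \<open>poisson_process M lamE E\<close> and P = \<open>poisson_process M' 1 P\<close>
  note [measurable] = poisson_processD(1)[OF L] poisson_processD(1)[OF E]
    measurable_poisson_void_space[OF E] measurable_poisson_void_space[OF P]
    measurable_typical_in_degree
  \<comment> \<open>The origin is removed because a node has no edge to itself; a single point has
    area 0.\<close>
  have cell: "typical_voronoi_cell (E \<omega>) - {0} \<in> sets borel" if "\<omega> \<in> space M" for \<omega>
    using borel_typical_voronoi_cell[OF poisson_process_locally_finite[OF E that]] by auto
  have cell_area: "emeasure lborel (typical_voronoi_cell (E \<omega>) - {0}) =
      emeasure lborel (typical_voronoi_cell (E \<omega>))" if "\<omega> \<in> space M" for \<omega>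
    using borel_typical_voronoi_cell[OF poisson_process_locally_finite[OF E that]]
    by (intro emeasure_Diff_null_set) (auto simp: null_sets_def)
  have degree: "(\<lambda>\<omega>. typical_in_degree (L \<omega>) (E \<omega>)) \<in> borel_measurable M"
    using measurable_compose[OF measurable_Pair[OF poisson_processD(1)[OF L] poisson_processD(1)[OF E]]
        measurable_typical_in_degree] by simp
  then show "(\<lambda>\<omega>. typical_in_degree (L \<omega>) (E \<omega>)) \<in> borel_measurable M" .

  have "(\<integral>\<^sup>+\<omega>. typical_in_degree (L \<omega>) (E \<omega>) \<partial>M) =
      (\<integral>\<^sup>+\<omega>'. \<integral>\<^sup>+\<omega>. typical_in_degree (L \<omega>) (E \<omega>') \<partial>M \<partial>M)"
    by (rule nn_integral_indep_pair[OF assms(1,7) measurable_typical_in_degree])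
  also have "\<dots> = (\<integral>\<^sup>+\<omega>. ennreal lamL * emeasure lborel (typical_voronoi_cell (E \<omega>)) \<partial>M)"
    using poisson_mean[OF assms(1) L] assms(3) cell
    by (intro nn_integral_cong) (simp add: typical_in_degree_eq cell_area)
  also have "\<dots> = ennreal lamL * ennreal (1 / lamE)"
    by (subst nn_integral_cmult) (auto simp: mean_cell_area[OF assms(1) E assms(4)])
  also have "\<dots> = ennreal (lamL / lamE)"
    using assms(3,4) by (simp add: ennreal_mult[symmetric])
  finally show "(\<integral>\<^sup>+ \<omega>. typical_in_degree (L \<omega>) (E \<omega>) \<partial>M) = ennreal (lamL / lamE)" .

  \<comment> \<open>On a cell of infinite area \<open>measure\<close> would default to 0 and the
    exponential to 1. The finite mean area confines this to a null set.\<close>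
  have finite_area: "AE \<omega> in M. emeasure lborel (typical_voronoi_cell (E \<omega>)) \<noteq> \<infinity>"
    by (rule nn_integral_PInf_AE) (auto simp: mean_cell_area[OF assms(1) E assms(4)])
  \<comment> \<open>Isolation as a function of the pair of configurations, so that its probability
    can be conditioned on \<open>E\<close> like the mean.\<close>
  define isol :: "(real ^ 2) set \<Rightarrow> (real ^ 2) set \<Rightarrow> ennreal" where
    "isol = (\<lambda>l e. indicator {0} (typical_in_degree l e))"
  have isol: "(\<lambda>(l, e). isol l e) \<in> borel_measurable (config_space \<Otimes>\<^sub>M config_space)"
    using measurable_compose[OF measurable_typical_in_degree borel_measurable_indicator[of "{0}" borel]]
    by (simp add: isol_def case_prod_beta')
  have "emeasure M {\<omega> \<in> space M. typical_in_degree (L \<omega>) (E \<omega>) = 0} =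
      (\<integral>\<^sup>+\<omega>. indicator {\<omega> \<in> space M. typical_in_degree (L \<omega>) (E \<omega>) = 0} \<omega> \<partial>M)"
    using degree by (intro nn_integral_indicator[symmetric]) simp
  also have "\<dots> = (\<integral>\<^sup>+\<omega>. isol (L \<omega>) (E \<omega>) \<partial>M)"
    by (intro nn_integral_cong) (auto simp: isol_def indicator_def)
  also have "\<dots> = (\<integral>\<^sup>+\<omega>'. \<integral>\<^sup>+\<omega>. isol (L \<omega>) (E \<omega>') \<partial>M \<partial>M)"
    by (rule nn_integral_indep_pair[OF assms(1,7) isol])
  also have "\<dots> = (\<integral>\<^sup>+\<omega>. ennreal (exp (- lamL * measure lborel (typical_voronoi_cell (E \<omega>)))) \<partial>M)"
  proof (rule nn_integral_cong_AE, use finite_area AE_space in eventually_elim)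
    fix \<omega>' assume fin: "emeasure lborel (typical_voronoi_cell (E \<omega>')) \<noteq> \<infinity>" and \<omega>': "\<omega>' \<in> space M"
    define B where "B = typical_voronoi_cell (E \<omega>') - {0}"
    have B: "B \<in> sets borel" "emeasure lborel B \<noteq> \<infinity>"
      "measure lborel B = measure lborel (typical_voronoi_cell (E \<omega>'))"
      using cell[OF \<omega>'] cell_area[OF \<omega>'] fin by (auto simp: B_def measure_def)
    \<comment> \<open>With \<open>E\<close> fixed, isolation says that \<open>L\<close> misses the
      set \<open>B\<close>, whose void probability is known.\<close>
    have "(\<integral>\<^sup>+\<omega>. isol (L \<omega>) (E \<omega>') \<partial>M) = (\<integral>\<^sup>+\<omega>. indicator {\<omega> \<in> space M. L \<omega> \<inter> B = {}} \<omega> \<partial>M)"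
      by (intro nn_integral_cong)
         (auto simp: isol_def indicator_def typical_in_degree_eq B_def emeasure_count_space_eq_0)
    also have "\<dots> = ennreal (exp (- (lamL * measure lborel B)))"
      using poisson_void[OF assms(1) L B(1,2)] poisson_void_event_in_sets[OF L B(1)]
      by (simp add: emeasure_eq_measure)
    finally show "(\<integral>\<^sup>+\<omega>. isol (L \<omega>) (E \<omega>') \<partial>M) =
        ennreal (exp (- lamL * measure lborel (typical_voronoi_cell (E \<omega>'))))"
      by (simp add: B(3))
  qed
  also have "\<dots> = ennreal (\<integral>\<omega>. exp (- lamL * measure lborel (typical_voronoi_cell (E \<omega>))) \<partial>M)"
    using assms(3) measurable_compose[OF measurable_poisson_void_space[OF E]
        measurable_exp_cell_area[of "- lamL"]]
    by (intro nn_integral_eq_integral integrable_const_bound[where B = 1]) auto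
  finally have "measure M {\<omega> \<in> space M. typical_in_degree (L \<omega>) (E \<omega>) = 0} =
      (\<integral>\<omega>. exp (- lamL * measure lborel (typical_voronoi_cell (E \<omega>))) \<partial>M)"
    by (simp add: emeasure_eq_measure)
  \<comment> \<open>Scaling lengths by \<open>sqrt lamE\<close> multiplies the area by
    \<open>lamE\<close>, which the factor \<open>lamL / lamE\<close> compensates.\<close>
  also have "\<dots> = (\<integral>\<omega>. exp (- (lamL / lamE) *
      measure lborel (typical_voronoi_cell ((*\<^sub>R) (sqrt lamE) ` E \<omega>))) \<partial>M)"
  proof (rule Bochner_Integration.integral_cong)
    fix \<omega> assume "\<omega> \<in> space M"
    then show "exp (- lamL * measure lborel (typical_voronoi_cell (E \<omega>))) =
      exp (- (lamL / lamE) * measure lborel (typical_voronoi_cell ((*\<^sub>R) (sqrt lamE) ` E \<omega>)))"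
      using assms(4) borel_typical_voronoi_cell[OF poisson_process_locally_finite[OF E]]
      by (simp add: typical_voronoi_cell_scale measure_lborel_scale)
  qed simp
  \<comment> \<open>The scaled \<open>E\<close> and \<open>P\<close> live on different probability
    spaces, so the expectation is moved to their common law on \<open>void_space\<close>.\<close>
  also have "\<dots> = (\<integral>e. exp (- (lamL / lamE) * measure lborel (typical_voronoi_cell e))
      \<partial>distr M void_space (\<lambda>\<omega>. (*\<^sub>R) (sqrt lamE) ` E \<omega>))"
    using assms(4)
    by (intro integral_distr[symmetric] measurable_exp_cell_area
        measurable_compose[OF measurable_poisson_void_space[OF E] measurable_scale_void_space]) simp
  also have "\<dots> = (\<integral>\<omega>. exp (- (lamL / lamE) * measure lborel (typical_voronoi_cell (P \<omega>))) \<partial>M')"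
    unfolding poisson_scale_law[OF assms(1,2,4) E P]
    by (intro integral_distr measurable_exp_cell_area measurable_poisson_void_space[OF P])
  finally show "measure M {\<omega> \<in> space M. typical_in_degree (L \<omega>) (E \<omega>) = 0} =
      (\<integral>\<omega>. exp (- (lamL / lamE) * measure lborel (typical_voronoi_cell (P \<omega>))) \<partial>M')" .
qed

end
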